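(* Let $S:\mathbb{R}^n\to\mathbb{R}$, $S(u)=u_1+\cdots+u_n$, and let $H=S^{-1}(0)=\{u\in\mathbb{R}^n : u_1+\cdots+u_n=0\}$. Let $g:H\to H$ be a $C^2$ function, and let $R\subseteq H$ be a compact region. Then there exists a $C^2$ function $f:\mathbb{R}^n\to\mathbb{R}^n$ such that: (1) for every $u\in\mathbb{R}^n$ and every $i\neq j$, $\dfrac{\partial f_i}{\partial u_j}(u)>0$; (2) for every $u\in R$, $g(u)=f(u)$; (3) there exists $P>0$ such that every solution $u(t)$ of the system $\dfrac{du_i}{dt}=f_i(u)$, $i=1,\ldots,n$, with $S(u(0))>0$ converges towards $(P,\ldots,P)$ as $t\to\infty$, and every solution $u(t)$ of this system with $S(u(0))<0$ converges towards $(-P,\ldots,-P)$ as $t\to\infty$; (4) if $g(u)\cdot u<0$ for all $u\in H\setminus R$, then $f$ has no zeros other than the zeros of $g$ and the two points $\pm(P,\ldots,P)$, with $P$ as in (3).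
   Context: Here $n$ is a positive integer, $u=(u_1,\ldots,u_n)\in\mathbb{R}^n$, and $f=(f_1,\ldots,f_n)$. The symbol $\cdot$ denotes the Euclidean inner product on $\mathbb{R}^n$. The set $H$ is regarded as an $(n-1)$-dimensional linear subspace of $\mathbb{R}^n$, and $C^2$ for functions on $H$ is understood accordingly. A compact region of $H$ means a compact subset of $H$. *)

theory Defs
  imports "HOL-Analysis.Analysis"
begin

definition coord_sum :: "real ^ 'n \<Rightarrow> real" where
  "coord_sum u = (\<Sum>i\<in>UNIV. u $ i)"

definition zero_sum_space :: "(real ^ 'n) set" where
  "zero_sum_space = {u. coord_sum u = 0}"

(* Intended for a linear subspace V (or V = UNIV).  The derivative maps D x and D2 x
   live on the ambient space, but only their restrictions to directions in V are
   determined.  A derivative that is defined only on V extends to the ambient space by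
   composition with the orthogonal projection onto V, so on a subspace of a Euclidean
   space this is C^2 in the sense of the normed space V. *)
definition C2_on :: "'a::real_normed_vector set \<Rightarrow> ('a \<Rightarrow> 'b::real_normed_vector) \<Rightarrow> bool" where
  "C2_on V F \<longleftrightarrow>
     (\<exists>(D :: 'a \<Rightarrow> 'a \<Rightarrow>\<^sub>L 'b) (D2 :: 'a \<Rightarrow> 'a \<Rightarrow>\<^sub>L ('a \<Rightarrow>\<^sub>L 'b)).
        (\<forall>x\<in>V. (F has_derivative blinfun_apply (D x)) (at x within V)) \<and>
        (\<forall>x\<in>V. (D has_derivative blinfun_apply (D2 x)) (at x within V)) \<and>
        continuous_on V D2)"

definition partial_deriv :: "'n \<Rightarrow> (real ^ 'n \<Rightarrow> real) \<Rightarrow> real ^ 'n \<Rightarrow> real" where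
  "partial_deriv j F u = deriv (\<lambda>s. F (u + s *\<^sub>R axis j 1)) 0"

definition ode_solution ::
    "('a::real_normed_vector \<Rightarrow> 'a) \<Rightarrow> real set \<Rightarrow> (real \<Rightarrow> 'a) \<Rightarrow> bool" where
  "ode_solution F J u \<longleftrightarrow>
     is_interval J \<and> 0 \<in> J \<and> (\<forall>t\<in>J. (u has_vector_derivative F (u t)) (at t within J))"

(* Any solution on [0,\<infinity>) is forward maximal, with J = {0..}; a solution that leaves every
   bounded set in finite time is forward maximal on some J = {0..<T}. *)
definition forward_maximal_solution ::
    "('a::real_normed_vector \<Rightarrow> 'a) \<Rightarrow> real set \<Rightarrow> (real \<Rightarrow> 'a) \<Rightarrow> bool" where
  "forward_maximal_solution F J u \<longleftrightarrow>
     J \<subseteq> {0..} \<and> ode_solution F J u \<and>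
     (\<forall>K w. K \<subseteq> {0..} \<and> ode_solution F K w \<and> J \<subseteq> K \<and> (\<forall>t\<in>J. w t = u t) \<longrightarrow> K = J)"

end

theory Submission
  imports Defs
begin

text \<open>
  Write \<open>m\<close> for the mean of the coordinates of \<open>u\<close> and \<open>v = u - (m,\<dots>,m)\<close> for its deviation,
  the orthogonal projection of \<open>u\<close> to the hyperplane \<open>H\<close>.  The vector field is
  \<open>f(u) = N(u) - v + (\<phi>(m),\<dots>,\<phi>(m))\<close>.
  Here \<open>N\<close> takes values in \<open>H\<close> and equals \<open>g(u) + u\<close> on \<open>R\<close>; it is cut off so that it has
  bounded support and vanishes for \<open>\<bar>m\<bar> \<ge> 1\<close>.  The scalar function is
  \<open>\<phi>(m) = m (A / sqrt (1 + m^2) - 1/2)\<close> with a large constant \<open>A\<close>.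

  The three terms divide the work as follows.

  \<^item> Cooperativity: for \<open>i \<noteq> j\<close> and \<open>n\<close> coordinates, \<open>- v\<close> contributes \<open>1/n\<close> to
    \<open>\<partial>f_i/\<partial>u_j\<close>, and the last term contributes \<open>\<phi>'(m)/n\<close>, which always exceeds
    \<open>- 1/(2n)\<close>.  This suffices where \<open>N\<close> vanishes.  In the slab \<open>\<bar>m\<bar> \<le> 1\<close> the derivative of \<open>N\<close>
    is bounded, because \<open>N\<close> has bounded support, and there \<open>\<phi>'(m) \<ge> A/3 - 1/2\<close>, so that a
    large \<open>A\<close> outweighs \<open>N\<close> (\<open>partial_deriv_cooperative_field_pos\<close>).

  \<^item> Dynamics: \<open>N\<close> and \<open>v\<close> have mean zero, so the mean evolves autonomously by
    \<open>m' = \<phi>(m)\<close>.  The zeros of \<open>\<phi>\<close> are \<open>0\<close> and \<open>\<plusminus>P\<close> with \<open>P = sqrt (4 A^2 - 1) > 1\<close>, and \<open>m\<close> tends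
    to \<open>P\<close> or \<open>- P\<close> according to its initial sign (\<open>growth_flow_converges\<close>).  Once \<open>\<bar>m\<bar> > 1\<close>,
    the perturbation is switched off and \<open>v' = - v\<close>, so \<open>v\<close> tends to \<open>0\<close>
    (\<open>cooperative_field_solution_converges\<close>).

  \<^item> Maximal solutions: every term of \<open>f\<close> is globally Lipschitz, so each initial value has a
    unique solution on \<open>[0,\<infinity>)\<close>; a forward maximal solution must therefore be that one
    (\<open>lipschitz_forward_maximal_global\<close>).

  \<^item> Zeros: a zero of \<open>f\<close> has \<open>m = \<plusminus>P\<close>, and then \<open>v = 0\<close>, or \<open>m = 0\<close> and \<open>N(u) = u\<close>.  In the second
    case, if \<open>u\<close> is outside \<open>R\<close> and \<open>g(u) \<bullet> u < 0\<close>, then \<open>N(u) \<bullet> u < u \<bullet> u\<close>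
    (\<open>perturbation_inner_less\<close>), which is absurd; so \<open>u\<close> lies in \<open>R\<close>, where \<open>N(u) = u\<close> means
    \<open>g(u) = 0\<close>.
\<close>

section \<open>Calculus of functions of class C1 and C2\<close>

text \<open>
  A map is C2 if and only if it has a derivative map that is C1.  Hence each closure property of
  C2 functions comes from the formula for the derivative together with the corresponding closure
  properties of C1 functions, applied to operator-valued maps.
\<close>

definition C1_on :: "'a::real_normed_vector set \<Rightarrow> ('a \<Rightarrow> 'b::real_normed_vector) \<Rightarrow> bool" where
  "C1_on V F \<longleftrightarrow> (\<exists>D :: 'a \<Rightarrow> 'a \<Rightarrow>\<^sub>L 'b.
     (\<forall>x\<in>V. (F has_derivative blinfun_apply (D x)) (at x within V)) \<and> continuous_on V D)"

lemma C1_onI: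
  assumes "\<And>x. x \<in> V \<Longrightarrow> (F has_derivative blinfun_apply (D x)) (at x within V)" "continuous_on V D"
  shows "C1_on V F"
  using assms unfolding C1_on_def by blast

lemma C2_on_iff:
  "C2_on V F \<longleftrightarrow> (\<exists>D :: 'a::real_normed_vector \<Rightarrow> 'a \<Rightarrow>\<^sub>L 'b::real_normed_vector.
     (\<forall>x\<in>V. (F has_derivative blinfun_apply (D x)) (at x within V)) \<and> C1_on V D)"
  unfolding C2_on_def C1_on_def by blast

lemma C2_onI:
  assumes "\<And>x. x \<in> V \<Longrightarrow> (F has_derivative blinfun_apply (D x)) (at x within V)" "C1_on V D"
  shows "C2_on V F"
  using assms unfolding C2_on_iff by blast

lemma C1_on_imp_continuous_on: "C1_on V F \<Longrightarrow> continuous_on V F"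
  unfolding C1_on_def by (auto simp: continuous_on_eq_continuous_within intro: has_derivative_continuous)

lemma C2_on_imp_C1_on: "C2_on V F \<Longrightarrow> C1_on V F"
  unfolding C2_on_iff C1_on_def[of V F] by (blast dest: C1_on_imp_continuous_on)

lemma C1_on_const: "C1_on V (\<lambda>x. c)"
  by (rule C1_onI[where D = "\<lambda>x. 0"]) (auto simp: zero_blinfun.rep_eq)

lemma C2_on_const: "C2_on V (\<lambda>x. c)"
  by (rule C2_onI[where D = "\<lambda>x. 0"]) (auto simp: zero_blinfun.rep_eq C1_on_const)

lemma C1_on_bounded_linear:
  assumes "bounded_linear L" shows "C1_on V L"
  by (rule C1_onI[where D = "\<lambda>x. Blinfun L"])
     (use assms in \<open>auto simp: bounded_linear_Blinfun_apply bounded_linear_imp_has_derivative\<close>)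

lemma C2_on_bounded_linear:
  assumes "bounded_linear L" shows "C2_on V L"
  by (rule C2_onI[where D = "\<lambda>x. Blinfun L"])
     (use assms in \<open>auto simp: bounded_linear_Blinfun_apply bounded_linear_imp_has_derivative C1_on_const\<close>)

lemma C1_on_add:
  assumes "C1_on V F" "C1_on V G" shows "C1_on V (\<lambda>x. F x + G x)"
proof -
  obtain D where "\<forall>x\<in>V. (F has_derivative blinfun_apply (D x)) (at x within V)" "continuous_on V D"
    using assms(1) unfolding C1_on_def by blast
  moreover obtain E where "\<forall>x\<in>V. (G has_derivative blinfun_apply (E x)) (at x within V)" "continuous_on V E"
    using assms(2) unfolding C1_on_def by blast
  ultimately show ?thesis
    by (intro C1_onI[where D = "\<lambda>x. D x + E x"])
       (simp_all add: plus_blinfun.rep_eq has_derivative_add continuous_on_add)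
qed

lemma C2_on_add:
  assumes "C2_on V F" "C2_on V G" shows "C2_on V (\<lambda>x. F x + G x)"
proof -
  obtain D where "\<forall>x\<in>V. (F has_derivative blinfun_apply (D x)) (at x within V)" "C1_on V D"
    using assms(1) unfolding C2_on_iff by blast
  moreover obtain E where "\<forall>x\<in>V. (G has_derivative blinfun_apply (E x)) (at x within V)" "C1_on V E"
    using assms(2) unfolding C2_on_iff by blast
  ultimately show ?thesis
    by (intro C2_onI[where D = "\<lambda>x. D x + E x"])
       (simp_all add: plus_blinfun.rep_eq has_derivative_add C1_on_add)
qed

lemma C1_on_compose:
  assumes "C1_on W G" "C1_on V F" "F ` V \<subseteq> W"
  shows "C1_on V (\<lambda>x. G (F x))"
proof -
  obtain D where D: "\<forall>x\<in>V. (F has_derivative blinfun_apply (D x)) (at x within V)" "continuous_on V D"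
    using assms(2) unfolding C1_on_def by blast
  obtain E where E: "\<forall>x\<in>W. (G has_derivative blinfun_apply (E x)) (at x within W)" "continuous_on W E"
    using assms(1) unfolding C1_on_def by blast
  have cF: "continuous_on V F" using assms(2) by (rule C1_on_imp_continuous_on)
  show ?thesis
  proof (rule C1_onI[where D = "\<lambda>x. E (F x) o\<^sub>L D x"])
    fix x assume x: "x \<in> V"
    have "(G has_derivative E (F x)) (at (F x) within F ` V)"
      using E(1) x assms(3) by (blast intro: has_derivative_subset)
    from diff_chain_within[OF D(1)[rule_format, OF x] this]
    show "((\<lambda>x. G (F x)) has_derivative (E (F x) o\<^sub>L D x)) (at x within V)"
      by (simp add: o_def blinfun_compose.rep_eq)
  qed (intro continuous_intros D(2) continuous_on_compose2[OF E(2) cF assms(3)])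
qed

text \<open>
  The product rule in operator form: the derivative of \<open>B (F x) (G x)\<close> is a sum of compositions
  of operators, each depending continuously on \<open>x\<close>.  Stated for every bounded bilinear map, it
  covers products, inner products, and the composition of derivatives in the chain rule.
\<close>

lemma C1_on_bilinear:
  assumes B: "bounded_bilinear B" and F: "C1_on V F" and G: "C1_on V G"
  shows "C1_on V (\<lambda>x. B (F x) (G x))"
proof -
  obtain D where D: "\<forall>x\<in>V. (F has_derivative blinfun_apply (D x)) (at x within V)" "continuous_on V D"
    using F unfolding C1_on_def by blast
  obtain E where E: "\<forall>x\<in>V. (G has_derivative blinfun_apply (E x)) (at x within V)" "continuous_on V E"
    using G unfolding C1_on_def by blast
  note cF = C1_on_imp_continuous_on[OF F] C1_on_imp_continuous_on[OF G]
  interpret bounded_bilinear B by (fact B)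
  show ?thesis
    by (rule C1_onI[where D = "\<lambda>x. (prod_right (F x) o\<^sub>L E x) + (prod_left (G x) o\<^sub>L D x)"])
       (auto simp: blinfun.bilinear_simps plus_blinfun.rep_eq prod_left.rep_eq prod_right.rep_eq
         intro!: continuous_intros D(2) E(2) FDERIV cF bspec[OF D(1)] bspec[OF E(1)])
qed

lemma C2_on_compose:
  assumes "C2_on W G" "C2_on V F" "F ` V \<subseteq> W"
  shows "C2_on V (\<lambda>x. G (F x))"
proof -
  obtain D where D: "\<forall>x\<in>V. (F has_derivative blinfun_apply (D x)) (at x within V)" "C1_on V D"
    using assms(2) unfolding C2_on_iff by blast
  obtain E where E: "\<forall>x\<in>W. (G has_derivative blinfun_apply (E x)) (at x within W)" "C1_on W E"
    using assms(1) unfolding C2_on_iff by blast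
  show ?thesis
  proof (rule C2_onI[where D = "\<lambda>x. E (F x) o\<^sub>L D x"])
    fix x assume x: "x \<in> V"
    have "(G has_derivative E (F x)) (at (F x) within F ` V)"
      using E(1) x assms(3) by (blast intro: has_derivative_subset)
    from diff_chain_within[OF D(1)[rule_format, OF x] this]
    show "((\<lambda>x. G (F x)) has_derivative (E (F x) o\<^sub>L D x)) (at x within V)"
      by (simp add: o_def blinfun_compose.rep_eq)
  qed (intro C1_on_bilinear[OF bounded_bilinear_blinfun_compose] D(2)
      C1_on_compose[OF E(2) C2_on_imp_C1_on[OF assms(2)] assms(3)])
qed

lemma C2_on_bilinear:
  assumes B: "bounded_bilinear B" and F: "C2_on V F" and G: "C2_on V G"
  shows "C2_on V (\<lambda>x. B (F x) (G x))"
proof -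
  obtain D where D: "\<forall>x\<in>V. (F has_derivative blinfun_apply (D x)) (at x within V)" "C1_on V D"
    using F unfolding C2_on_iff by blast
  obtain E where E: "\<forall>x\<in>V. (G has_derivative blinfun_apply (E x)) (at x within V)" "C1_on V E"
    using G unfolding C2_on_iff by blast
  interpret bounded_bilinear B by (fact B)
  note comp = C1_on_bilinear[OF bounded_bilinear_blinfun_compose]
  note right = C1_on_compose[OF C1_on_bounded_linear[OF bounded_linear_prod_right, of UNIV] C2_on_imp_C1_on[OF F] subset_UNIV]
  note left = C1_on_compose[OF C1_on_bounded_linear[OF bounded_linear_prod_left, of UNIV] C2_on_imp_C1_on[OF G] subset_UNIV]
  show ?thesis
    by (rule C2_onI[where D = "\<lambda>x. (prod_right (F x) o\<^sub>L E x) + (prod_left (G x) o\<^sub>L D x)"],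
        (auto simp: blinfun.bilinear_simps plus_blinfun.rep_eq prod_left.rep_eq prod_right.rep_eq
         intro!: FDERIV bspec[OF D(1)] bspec[OF E(1)])[1])
       (intro C1_on_add comp left right D(2) E(2))
qed

lemma C2_on_real:
  fixes q q' q'' :: "real \<Rightarrow> real"
  assumes q: "\<And>x. (q has_real_derivative q' x) (at x)"
    and q': "\<And>x. (q' has_real_derivative q'' x) (at x)"
    and q'': "continuous_on UNIV q''"
  shows "C2_on UNIV q"
proof (rule C2_onI[where D = "\<lambda>x. blinfun_mult_right (q' x)"])
  have "C1_on UNIV q'"
  proof (rule C1_onI[where D = "\<lambda>x. blinfun_mult_right (q'' x)"])
    show "continuous_on UNIV (\<lambda>x. blinfun_mult_right (q'' x))"
      by (intro continuous_intros q'')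
  qed (use q' in \<open>simp add: has_field_derivative_def blinfun_mult_right.rep_eq\<close>)
  then show "C1_on UNIV (\<lambda>x. blinfun_mult_right (q' x))"
    by (rule C1_on_compose[OF C1_on_bounded_linear[OF bounded_linear_blinfun_mult_right]])
      (rule subset_UNIV)
qed (use q in \<open>simp add: has_field_derivative_def blinfun_mult_right.rep_eq\<close>)

text \<open>
  The derivative is continuous, hence bounded on the compact ball, and it vanishes outside the
  ball because the function is locally constant there.
\<close>

lemma C1_bounded_support_bounded_derivative:
  fixes F :: "'a::euclidean_space \<Rightarrow> 'b::real_normed_vector"
  assumes F: "C1_on UNIV F" and supp: "\<And>x. r < norm x \<Longrightarrow> F x = 0"
  obtains D B where "\<And>x. (F has_derivative blinfun_apply (D x)) (at x)" "\<And>x. norm (D x) \<le> B"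
proof -
  obtain D where D: "\<And>x. (F has_derivative blinfun_apply (D x)) (at x)" "continuous_on UNIV D"
    using F unfolding C1_on_def by auto
  have "bounded (D ` cball 0 r)"
    by (intro compact_imp_bounded compact_continuous_image continuous_on_subset[OF D(2)]) auto
  then obtain B where B: "\<forall>x\<in>cball 0 r. norm (D x) \<le> B"
    by (auto simp: bounded_iff)
  have out: "D x = 0" if "r < norm x" for x
  proof -
    have "open (- cball 0 r :: 'a set)" by (intro open_Compl) auto
    then have "((\<lambda>x. 0) has_derivative blinfun_apply (D x)) (at x)"
      by (rule has_derivative_transform_within_open[OF D(1)]) (use that supp in auto)
    then have "blinfun_apply (D x) = (\<lambda>h. 0)"
      using has_derivative_unique has_derivative_const by blast
    then show ?thesis by (intro blinfun_eqI) simp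
  qed
  have "norm (D x) \<le> max B 0" for x
    using bspec[OF B, of x] out[of x] by (cases "r < norm x") auto
  with D(1) show ?thesis by (rule that)
qed

section \<open>C2 cutoff functions\<close>

text \<open>
  At \<open>0\<close> the difference quotient is bounded by \<open>\<bar>h\<bar> ^ (n - 1)\<close>, which tends to \<open>0\<close>; this is
  where \<open>2 \<le> n\<close> enters.
\<close>

lemma has_real_derivative_pos_part_power:
  fixes x :: real
  assumes "2 \<le> n"
  shows "((\<lambda>x. max 0 x ^ n) has_real_derivative of_nat n * max 0 x ^ (n - 1)) (at x)"
proof (cases x "0::real" rule: linorder_cases)
  case less
  have "((\<lambda>x. 0) has_real_derivative of_nat n * max 0 x ^ (n - 1)) (at x)"
    using less assms by (auto simp: max_def zero_power)
  moreover have "\<forall>\<^sub>F y in nhds x. max 0 y ^ n = (0::real)"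
    using eventually_nhds_in_open[of "{..<0}" x] less assms
    by (auto elim!: eventually_mono simp: max_def)
  ultimately show ?thesis by (rule iffD2[OF DERIV_cong_ev[OF refl _ refl], rotated])
next
  case greater
  have "((\<lambda>x. x ^ n) has_real_derivative of_nat n * max 0 x ^ (n - 1)) (at x)"
    using greater by (auto intro!: derivative_eq_intros simp: max_def)
  moreover have "\<forall>\<^sub>F y in nhds x. max 0 y ^ n = y ^ n"
    using eventually_nhds_in_open[of "{0<..}" x] greater
    by (auto elim!: eventually_mono simp: max_def)
  ultimately show ?thesis by (rule iffD2[OF DERIV_cong_ev[OF refl _ refl], rotated])
next
  case equal
  have "((\<lambda>h. max 0 h ^ n / h) \<longlongrightarrow> 0) (at (0::real))"
  proof (rule Lim_null_comparison)
    have "\<bar>max 0 h ^ n / h\<bar> \<le> \<bar>h\<bar> ^ (n - 1)" for h :: real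
      using assms by (cases n) (auto simp: max_def abs_mult power_abs)
    then show "\<forall>\<^sub>F h in at (0::real). norm (max 0 h ^ n / h) \<le> \<bar>h\<bar> ^ (n - 1)"
      by simp
    show "((\<lambda>h. \<bar>h\<bar> ^ (n - 1)) \<longlongrightarrow> 0) (at (0::real))"
      using assms by (auto intro!: tendsto_eq_intros simp: zero_power)
  qed
  then show ?thesis
    using equal assms by (simp add: DERIV_def zero_power)
qed

lemma C2_on_pos_part_cubed: "C2_on UNIV (\<lambda>x::real. max 0 x ^ 3)"
proof (rule C2_on_real[where q' = "\<lambda>x. 3 * max 0 x ^ 2" and q'' = "\<lambda>x. 3 * (2 * max 0 x)"])
  show "((\<lambda>x. max 0 x ^ 3) has_real_derivative 3 * max 0 x ^ 2) (at x)" for x :: real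
    using has_real_derivative_pos_part_power[of 3 x] by simp
  show "((\<lambda>x. 3 * max 0 x ^ 2) has_real_derivative 3 * (2 * max 0 x)) (at x)" for x :: real
    using DERIV_cmult[OF has_real_derivative_pos_part_power[of 2 x], of 3] by simp
qed (intro continuous_intros)

text \<open>
  A piecewise polynomial substitute for a bump function: class C2 is all that the construction
  asks for, and the cube of the positive part has it.
\<close>

definition cutoff :: "real \<Rightarrow> real \<Rightarrow> real" where
  "cutoff r x = max 0 (1 - max 0 (x - r) ^ 3) ^ 3"

lemma C2_on_cutoff: "C2_on UNIV (cutoff r)"
proof -
  have shift: "C2_on UNIV (\<lambda>x::real. x - r)"
    using C2_on_add[OF C2_on_bounded_linear[OF bounded_linear_ident] C2_on_const[of UNIV "- r"]] by simp
  have flip: "C2_on UNIV (\<lambda>x::real. 1 - x)"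
    using C2_on_add[OF C2_on_const[of UNIV 1] C2_on_bounded_linear[OF bounded_linear_minus[OF bounded_linear_ident]]]
    by simp
  note cube = C2_on_compose[OF C2_on_pos_part_cubed _ subset_UNIV]
  show ?thesis
    unfolding cutoff_def[abs_def]
    by (rule cube, rule C2_on_compose[OF flip _ subset_UNIV], rule cube, rule shift)
qed

lemma cutoff_simps:
  shows "x \<le> r \<Longrightarrow> cutoff r x = 1" and "r + 1 \<le> x \<Longrightarrow> cutoff r x = 0"
    and "0 \<le> cutoff r x" and "cutoff r x \<le> 1"
proof -
  show "x \<le> r \<Longrightarrow> cutoff r x = 1" "0 \<le> cutoff r x" by (auto simp: cutoff_def)
  show "cutoff r x \<le> 1" unfolding cutoff_def by (rule power_le_one) auto
  show "cutoff r x = 0" if "r + 1 \<le> x"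
  proof -
    have "1 \<le> max 0 (x - r) ^ 3" using that by (intro one_le_power) auto
    then show ?thesis by (simp add: cutoff_def)
  qed
qed

section \<open>Global existence and uniqueness for Lipschitz differential equations\<close>

lemma nonincreasing_if_derivative_nonpos:
  fixes F F' :: "real \<Rightarrow> real"
  assumes "a \<le> b"
    and "\<And>t. t \<in> {a..b} \<Longrightarrow> (F has_real_derivative F' t) (at t within {a..b})"
    and "\<And>t. t \<in> {a..b} \<Longrightarrow> F' t \<le> 0"
  shows "F b \<le> F a"
proof -
  have "\<exists>x\<in>{a..b}. F b - F a = (*) (F' x) (b - a)"
    using assms(1,2) by (intro mvt_very_simple) (auto simp: has_field_derivative_def)
  then show ?thesis
    using assms(1,3) by (smt (verit) mult_nonpos_nonneg)
qed

text \<open>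
  Gronwall's argument: the squared distance of the two solutions, weighted by \<open>exp (- 2 L t)\<close>,
  cannot increase, and it starts at \<open>0\<close>.
\<close>

lemma lipschitz_ode_unique:
  fixes F :: "'a::real_inner \<Rightarrow> 'a"
  assumes F: "L-lipschitz_on UNIV F"
    and u: "ode_solution F J u" and w: "ode_solution F K w"
    and J: "J \<subseteq> K" "J \<subseteq> {0..}" and "u 0 = w 0" and "t \<in> J"
  shows "u t = w t"
proof -
  define q where "q s = exp (- 2 * L * s) * ((u s - w s) \<bullet> (u s - w s))" for s
  define q' where "q' s = exp (- 2 * L * s) * (2 * ((F (u s) - F (w s)) \<bullet> (u s - w s)))
       - 2 * L * exp (- 2 * L * s) * ((u s - w s) \<bullet> (u s - w s))" for s
  have "is_interval J" "0 \<in> J" using u by (auto simp: ode_solution_def)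
  then have "{0..t} \<subseteq> J" using mem_is_interval_1_I[of J 0 t] \<open>t \<in> J\<close> by auto
  with J \<open>t \<in> J\<close> have t: "0 \<le> t" "{0..t} \<subseteq> J" "{0..t} \<subseteq> K" by auto
  have "q t \<le> q 0"
  proof (rule nonincreasing_if_derivative_nonpos[OF t(1)])
    fix s assume s: "s \<in> {0..t}"
    have "(u has_vector_derivative F (u s)) (at s within {0..t})"
         "(w has_vector_derivative F (w s)) (at s within {0..t})"
      using u w s t has_vector_derivative_within_subset unfolding ode_solution_def by blast+
    from has_vector_derivative_diff[OF this]
    have "((\<lambda>s. u s - w s) has_derivative (\<lambda>h. h *\<^sub>R (F (u s) - F (w s)))) (at s within {0..t})"
      unfolding has_vector_derivative_def .
    from has_derivative_inner[OF this this]
    have "((\<lambda>s. (u s - w s) \<bullet> (u s - w s)) has_real_derivative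
        2 * ((F (u s) - F (w s)) \<bullet> (u s - w s))) (at s within {0..t})"
      unfolding has_field_derivative_def
      by (rule has_derivative_eq_rhs) (auto simp: inner_commute algebra_simps)
    then show "(q has_real_derivative q' s) (at s within {0..t})"
      unfolding q_def q'_def by (auto intro!: derivative_eq_intros)
    have "(F (u s) - F (w s)) \<bullet> (u s - w s) \<le> norm (F (u s) - F (w s)) * norm (u s - w s)"
      by (rule norm_cauchy_schwarz)
    also have "\<dots> \<le> (L * norm (u s - w s)) * norm (u s - w s)"
      using lipschitz_on_normD[OF F, of "u s" "w s"] by (intro mult_right_mono) auto
    also have "\<dots> = L * ((u s - w s) \<bullet> (u s - w s))"
      by (simp add: power2_norm_eq_inner[symmetric] power2_eq_square)
    finally show "q' s \<le> 0"
      unfolding q'_def by (simp add: mult.assoc mult.left_commute[of L] flip: right_diff_distrib)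
  qed
  also have "q 0 = 0" by (simp add: q_def \<open>u 0 = w 0\<close>)
  finally have "(u t - w t) \<bullet> (u t - w t) \<le> 0"
    unfolding q_def by (simp add: mult_le_0_iff)
  then show ?thesis by (metis inner_gt_zero_iff not_less right_minus_eq)
qed

lemma integral_exp_scaled:
  fixes m :: real
  assumes "m > 0" "0 \<le> t"
  shows "((\<lambda>s. C * exp (m * s)) has_integral C * (exp (m * t) - 1) / m) {0..t}"
proof -
  have "((\<lambda>s. C * exp (m * s)) has_integral (C * exp (m * t) / m - C * exp (m * 0) / m)) {0..t}"
    using assms by (intro fundamental_theorem_of_calculus)
      (auto simp flip: has_real_derivative_iff_has_vector_derivative intro!: derivative_eq_intros)
  then show ?thesis by (simp add: diff_divide_distrib right_diff_distrib)
qed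

lemma norm_integral_le_exp:
  fixes h :: "real \<Rightarrow> 'a::banach"
  assumes "m > 0" "0 \<le> t" "0 \<le> C" and "h integrable_on {0..t}"
    and "\<And>s. s \<in> {0..t} \<Longrightarrow> norm (h s) \<le> C * exp (m * s)"
  shows "norm (integral {0..t} h) \<le> C / m * exp (m * t)"
proof -
  note I = integral_exp_scaled[OF assms(1,2), of C]
  have "norm (integral {0..t} h) \<le> integral {0..t} (\<lambda>s. C * exp (m * s))"
    using assms I by (intro integral_norm_bound_integral) (auto simp: integrable_on_def)
  also have "\<dots> = C * (exp (m * t) - 1) / m" using I by (rule integral_unique)
  also have "\<dots> \<le> C / m * exp (m * t)"
    using assms by (simp add: field_simps)
  finally show ?thesis .
qed

text \<open>
  Picard iteration on the whole half-line at once.  A candidate solution is written as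
  \<open>x0 + exp (m t) y(t)\<close> with a bounded continuous \<open>y\<close>; for \<open>m = 2 L + 1\<close> the exponential weight turns
  the integral operator into a contraction, so no local solutions have to be glued.  The functions
  \<open>y\<close> live on the whole line, and negative times are clamped to \<open>0\<close>.
\<close>

lemma lipschitz_ode_global_existence:
  fixes F :: "'a::banach \<Rightarrow> 'a"
  assumes F: "L-lipschitz_on UNIV F"
  obtains w where "ode_solution F {0..} w" "w 0 = x0"
proof -
  (* any m > L would do: the contraction constant is L / m *)
  define m where "m = 2 * L + 1"
  have L: "0 \<le> L" using F by (rule lipschitz_on_nonneg)
  then have m: "0 < m" by (simp add: m_def)
  have cF: "continuous_on A F" for A
    using F lipschitz_on_continuous_on continuous_on_subset by blast
  define X :: "(real \<Rightarrow>\<^sub>C 'a) \<Rightarrow> real \<Rightarrow> 'a" where "X y s = x0 + exp (m * s) *\<^sub>R y s" for y s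
  have cX: "continuous_on A (\<lambda>s. F (X y s))" for A y
    unfolding X_def by (intro continuous_on_compose2[OF cF[of UNIV]] continuous_intros) auto
  define I where "I y t = exp (- (m * max 0 t)) *\<^sub>R integral {0..max 0 t} (\<lambda>s. F (X y s))" for y t
  have cI: "continuous_on UNIV (I y)" for y
  proof -
    have "continuous_on {0..} (\<lambda>t. integral {0..t} (\<lambda>s. F (X y s)))"
    proof (clarsimp simp: continuous_on_eq_continuous_within)
      fix t :: real assume t: "0 \<le> t"
      have "((\<lambda>t. integral {0..t} (\<lambda>s. F (X y s))) has_vector_derivative F (X y t)) (at t within {0..t+1})"
        using t by (intro integral_has_vector_derivative cX) auto
      then have "continuous (at t within {0..t+1}) (\<lambda>t. integral {0..t} (\<lambda>s. F (X y s)))"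
        by (rule has_vector_derivative_continuous)
      moreover have "at t within {0..t+1} = at t within {0..}"
        using t by (intro at_within_nhd[of _ "{..<t+1}"]) auto
      ultimately show "continuous (at t within {0..}) (\<lambda>t. integral {0..t} (\<lambda>s. F (X y s)))"
        by simp
    qed
    moreover have "continuous_on UNIV (\<lambda>t::real. max 0 t)" by (intro continuous_intros)
    ultimately have "continuous_on UNIV (\<lambda>t. integral {0..max 0 t} (\<lambda>s. F (X y s)))"
      by (rule continuous_on_compose2) auto
    then show ?thesis
      unfolding I_def by (intro continuous_intros)
  qed
  have bnd: "norm (F (X y s)) \<le> (norm (F x0) + L * norm y) * exp (m * s)" if "0 \<le> s" for y s
  proof -
    have "norm (F (X y s)) \<le> norm (F x0) + norm (F (X y s) - F x0)"
      using norm_triangle_sub[of "F (X y s)" "F x0"] .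
    also have "\<dots> \<le> norm (F x0) + L * norm (X y s - x0)"
      using lipschitz_on_normD[OF F, of "X y s" x0] by simp
    also have "\<dots> \<le> norm (F x0) * exp (m * s) + L * (exp (m * s) * norm y)"
      using that m L norm_bounded[of y s] mult_left_mono[of 1 "exp (m * s)" "norm (F x0)"]
      by (auto simp: X_def intro!: add_mono mult_left_mono)
    finally show ?thesis by (simp add: algebra_simps)
  qed
  have Ib: "norm (I y t) \<le> (norm (F x0) + L * norm y) / m" for y t
  proof -
    have "norm (integral {0..max 0 t} (\<lambda>s. F (X y s))) \<le> (norm (F x0) + L * norm y) / m * exp (m * max 0 t)"
      using m L bnd by (intro norm_integral_le_exp integrable_continuous_real cX) auto
    then show ?thesis by (simp add: I_def exp_minus field_simps)
  qed
  have mem: "I y \<in> bcontfun" for y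
    using cI Ib by (rule bcontfun_normI)
  define T where "T y = Bcontfun (I y)" for y
  have T: "apply_bcontfun (T y) = I y" for y
    unfolding T_def using mem by (rule Bcontfun_inverse)
  have contr: "dist (T y) (T z) \<le> 1 / 2 * dist y z" for y z
  proof (rule dist_bound)
    fix t
    have "norm (integral {0..max 0 t} (\<lambda>s. F (X y s) - F (X z s))) \<le> (L * dist y z) / m * exp (m * max 0 t)"
    proof (intro norm_integral_le_exp m)
      fix s assume "s \<in> {0..max 0 t}"
      have "norm (F (X y s) - F (X z s)) \<le> L * norm (X y s - X z s)"
        using lipschitz_on_normD[OF F, of "X y s" "X z s"] by simp
      also have "X y s - X z s = exp (m * s) *\<^sub>R (y s - z s)"
        by (simp add: X_def algebra_simps)
      also have "L * norm (exp (m * s) *\<^sub>R (y s - z s)) \<le> L * (exp (m * s) * dist y z)"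
        using L dist_bounded[of y s z] by (intro mult_left_mono) (auto simp: dist_norm)
      finally show "norm (F (X y s) - F (X z s)) \<le> L * dist y z * exp (m * s)"
        by (simp add: mult_ac)
    qed (use L in \<open>auto intro!: integrable_continuous_real continuous_intros cX\<close>)
    also have "integral {0..max 0 t} (\<lambda>s. F (X y s) - F (X z s))
        = integral {0..max 0 t} (\<lambda>s. F (X y s)) - integral {0..max 0 t} (\<lambda>s. F (X z s))"
      by (intro integral_diff integrable_continuous_real cX)
    finally have "norm (integral {0..max 0 t} (\<lambda>s. F (X y s)) - integral {0..max 0 t} (\<lambda>s. F (X z s)))
        \<le> L * dist y z / m * exp (m * max 0 t)" .
    then have "exp (- (m * max 0 t)) * norm (integral {0..max 0 t} (\<lambda>s. F (X y s)) - integral {0..max 0 t} (\<lambda>s. F (X z s)))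
        \<le> L * dist y z / m"
      by (simp add: exp_minus field_simps)
    then have "dist (I y t) (I z t) \<le> L * dist y z / m"
      by (simp add: I_def dist_norm flip: scaleR_diff_right)
    also have "\<dots> = L / m * dist y z" by simp
    also have "\<dots> \<le> 1 / 2 * dist y z"
      using L by (intro mult_right_mono) (auto simp: m_def field_simps)
    finally show "dist (T y t) (T z t) \<le> 1 / 2 * dist y z" by (simp add: T)
  qed
  then have "\<exists>!y. T y = y"
    by (intro banach_fix_type[of "1/2"]) auto
  then obtain y where y: "T y = y" by blast
  have sol: "X y t = x0 + integral {0..t} (\<lambda>s. F (X y s))" if "0 \<le> t" for t
  proof -
    have "y t = exp (- (m * t)) *\<^sub>R integral {0..t} (\<lambda>s. F (X y s))"
      using T[of y] that unfolding y I_def by simp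
    then show ?thesis by (simp add: X_def[of y t] exp_minus)
  qed
  have "(X y has_vector_derivative F (X y t)) (at t within {0..})" if t: "t \<in> {0..}" for t
  proof -
    have "((\<lambda>t. integral {0..t} (\<lambda>s. F (X y s))) has_vector_derivative F (X y t)) (at t within {0..t+1})"
      using t by (intro integral_has_vector_derivative cX) auto
    then have "((\<lambda>t. x0 + integral {0..t} (\<lambda>s. F (X y s))) has_vector_derivative F (X y t)) (at t within {0..t+1})"
      by (auto intro!: derivative_eq_intros)
    then have "(X y has_vector_derivative F (X y t)) (at t within {0..t+1})"
      by (rule has_vector_derivative_transform[rotated 2]) (use t sol in auto)
    moreover have "at t within {0..t+1} = at t within {0..}"
      using t by (intro at_within_nhd[of _ "{..<t+1}"]) auto
    ultimately show ?thesis by simp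
  qed
  then have "ode_solution F {0..} (X y)"
    unfolding ode_solution_def by (simp add: is_interval_ci)
  moreover have "X y 0 = x0" using sol[of 0] by simp
  ultimately show ?thesis by (rule that)
qed

text \<open>
  The global solution with the same initial value extends any solution, by uniqueness, so
  maximality leaves no room for a smaller domain.
\<close>

lemma lipschitz_forward_maximal_global:
  fixes F :: "'a::{real_inner, banach} \<Rightarrow> 'a"
  assumes F: "L-lipschitz_on UNIV F" and u: "forward_maximal_solution F J u"
  shows "J = {0..}"
proof -
  obtain w where w: "ode_solution F {0..} w" "w 0 = u 0"
    using lipschitz_ode_global_existence[OF F] by blast
  have J: "J \<subseteq> {0..}" "ode_solution F J u"
    and max: "\<And>K w. K \<subseteq> {0..} \<Longrightarrow> ode_solution F K w \<Longrightarrow> J \<subseteq> K \<Longrightarrow> \<forall>t\<in>J. w t = u t \<Longrightarrow> K = J"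
    using u unfolding forward_maximal_solution_def by auto
  have "\<forall>t\<in>J. w t = u t"
    using lipschitz_ode_unique[OF F J(2) w(1) J(1) J(1)] w(2) by simp
  with max[OF order_refl w(1) J(1)] show ?thesis by simp
qed

section \<open>Scalar dynamics\<close>

text \<open>
  The distance to the rest point \<open>p\<close> never increases.  If it stayed above some \<open>e > 0\<close>, the
  solution would remain in a compact set on which \<open>(y - p) h(y)\<close> is bounded away from \<open>0\<close>, so
  \<open>(x - p)^2\<close> would fall at least linearly and become negative.
\<close>

lemma scalar_ode_converges:
  fixes x h :: "real \<Rightarrow> real"
  assumes der: "\<And>t. 0 \<le> t \<Longrightarrow> (x has_real_derivative h (x t)) (at t within {0..})"
    and cont: "continuous_on UNIV h"
    and sign: "\<And>y. y \<noteq> p \<Longrightarrow> (y - p) * h y < 0"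
  shows "(x \<longlongrightarrow> p) at_top"
proof -
  (* c = 0 gives monotonicity of the squared distance, c > 0 its linear decay *)
  have derV: "((\<lambda>t. (x t - p)\<^sup>2 + c * t) has_real_derivative 2 * ((x t - p) * h (x t)) + c) (at t within {a..b})"
    if "0 \<le> a" "t \<in> {a..b}" for a b t c
  proof -
    have "(x has_real_derivative h (x t)) (at t within {a..b})"
      using that by (intro DERIV_subset[OF der]) auto
    then show ?thesis by (auto intro!: derivative_eq_intros)
  qed
  have nonpos: "(y - p) * h y \<le> 0" for y
    using sign[of y] by (cases "y = p") auto
  have mono: "\<bar>x b - p\<bar> \<le> \<bar>x a - p\<bar>" if "0 \<le> a" "a \<le> b" for a b
  proof -
    have "(x b - p)\<^sup>2 + 0 * b \<le> (x a - p)\<^sup>2 + 0 * a"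
      by (rule nonincreasing_if_derivative_nonpos[OF that(2) derV[OF that(1), where c = 0]])
        (use nonpos in \<open>auto simp: mult.commute\<close>)
    then show ?thesis by (simp add: abs_le_square_iff)
  qed
  have near: "\<exists>T\<ge>0. \<bar>x T - p\<bar> < e" if e: "0 < e" for e
  proof (rule ccontr)
    assume "\<not> ?thesis"
    then have far: "e \<le> \<bar>x t - p\<bar>" if "0 \<le> t" for t using that by (meson not_less)
    define K where "K = cball p \<bar>x 0 - p\<bar> - ball p e"
    have inK: "x t \<in> K" if "0 \<le> t" for t
      using far[OF that] mono[of 0 t] that by (auto simp: K_def dist_real_def abs_minus_commute)
    have "compact K" unfolding K_def by (intro compact_diff) auto
    moreover have "K \<noteq> {}" using inK[of 0] by auto
    moreover have "continuous_on K (\<lambda>y. (y - p) * h y)"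
      by (intro continuous_intros continuous_on_subset[OF cont]) auto
    ultimately have "\<exists>z\<in>K. \<forall>y\<in>K. (y - p) * h y \<le> (z - p) * h z"
      by (rule continuous_attains_sup)
    then obtain z where z: "z \<in> K" "\<And>y. y \<in> K \<Longrightarrow> (y - p) * h y \<le> (z - p) * h z"
      by blast
    define d where "d = - ((z - p) * h z)"
    have "z \<noteq> p" using z(1) e by (auto simp: K_def)
    then have d: "0 < d" using sign[of z] by (simp add: d_def)
    (* by this time the linear bound on (x - p)^2 has dropped below 0 *)
    define T where "T = (x 0 - p)\<^sup>2 / (2 * d) + 1"
    have T: "0 \<le> T" using d by (auto simp: T_def intro!: add_nonneg_nonneg divide_nonneg_pos)
    have "(x T - p)\<^sup>2 + 2 * d * T \<le> (x 0 - p)\<^sup>2 + 2 * d * 0"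
    proof (rule nonincreasing_if_derivative_nonpos[OF T derV[OF order_refl, where c = "2 * d"]])
      show "2 * ((x t - p) * h (x t)) + 2 * d \<le> 0" if "t \<in> {0..T}" for t
        using z(2)[OF inK, of t] that by (auto simp: d_def)
    qed
    moreover have "2 * d * T = (x 0 - p)\<^sup>2 + 2 * d"
      using d by (simp add: T_def field_simps)
    ultimately show False using d zero_le_power2[of "x T - p"] by linarith
  qed
  show ?thesis
  proof (rule tendstoI)
    fix e :: real assume "0 < e"
    then obtain T where T: "0 \<le> T" "\<bar>x T - p\<bar> < e" using near by blast
    show "\<forall>\<^sub>F t in at_top. dist (x t) p < e"
      using eventually_ge_at_top[of T]
    proof eventually_elim
      case (elim t)
      then show ?case using mono[OF T(1) elim] T(2) by (simp add: dist_real_def)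
    qed
  qed
qed

text \<open>
  For \<open>A \<ge> 1\<close> an odd function with slope above \<open>- 1/2\<close> everywhere and large slope near \<open>0\<close> if \<open>A\<close> is
  large.  On the positive half-line it is positive up to its only zero there and negative beyond it.
  The slope must stay above \<open>- 1\<close> for the vector field to be cooperative away from the perturbation.
\<close>

definition growth :: "real \<Rightarrow> real \<Rightarrow> real" where
  "growth A s = s * (A / sqrt (1 + s\<^sup>2) - 1 / 2)"

definition growth_rest :: "real \<Rightarrow> real" where
  "growth_rest A = sqrt (4 * A\<^sup>2 - 1)"

lemma sqrt_one_plus_growth_rest:
  assumes "1 \<le> A"
  shows "sqrt (1 + (growth_rest A)\<^sup>2) = 2 * A"
proof -
  have "1 \<le> A\<^sup>2" using assms by simp
  then have "0 \<le> 4 * A\<^sup>2 - 1" by linarith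
  then have "1 + (growth_rest A)\<^sup>2 = (2 * A)\<^sup>2"
    by (simp add: growth_rest_def power_mult_distrib)
  then show ?thesis using assms by (metis abs_of_nonneg mult_nonneg_nonneg order_trans real_sqrt_abs zero_le_numeral zero_le_one)
qed

lemma growth_rest_gt_1:
  assumes "1 \<le> A"
  shows "1 < growth_rest A"
proof -
  have "1 \<le> A\<^sup>2" using assms by simp
  then have "1 < 4 * A\<^sup>2 - 1" by linarith
  then show ?thesis by (simp add: growth_rest_def)
qed

lemma growth_uminus: "growth A (- s) = - growth A s"
  by (simp add: growth_def)

lemma growth_eq_0:
  assumes "1 \<le> A" "growth A s = 0"
  shows "s = 0 \<or> \<bar>s\<bar> = growth_rest A"
proof (cases "s = 0")
  case False
  then have "sqrt (1 + s\<^sup>2) = 2 * A"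
    using assms(2) add_pos_nonneg[of 1 "s\<^sup>2"] by (auto simp: growth_def field_simps)
  then have "1 + s\<^sup>2 = 1 + (growth_rest A)\<^sup>2"
    using sqrt_one_plus_growth_rest[OF assms(1)] by (metis real_sqrt_eq_iff)
  then show ?thesis using growth_rest_gt_1[OF assms(1)]
    by (metis abs_of_pos add_left_cancel less_trans power2_eq_iff abs_minus_cancel zero_less_one)
qed simp

lemma growth_derivs:
  fixes A :: real
  defines "q \<equiv> \<lambda>s. A / (sqrt (1 + s\<^sup>2)) ^ 3 - 1 / 2"
    and "r \<equiv> \<lambda>s. - (3 * A * s) / (sqrt (1 + s\<^sup>2)) ^ 5"
  shows "(growth A has_real_derivative q s) (at s)"
    and "(q has_real_derivative r s) (at s)"
    and "continuous_on UNIV r"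
proof -
  have pos: "0 < 1 + s\<^sup>2" for s :: real by (simp add: add_pos_nonneg)
  have nz: "sqrt (1 + s\<^sup>2) \<noteq> 0" for s :: real using pos[of s] by simp
  have root: "((\<lambda>s. sqrt (1 + s\<^sup>2)) has_real_derivative s / sqrt (1 + s\<^sup>2)) (at s)" for s :: real
    using pos[of s] by (auto intro!: derivative_eq_intros simp: field_simps)
  define w where "w = sqrt (1 + s\<^sup>2)"
  have w: "0 < w" "w * w = 1 + s * s" using pos[of s] by (auto simp: w_def power2_eq_square)
  have "(growth A has_real_derivative (A / w - 1 / 2) + s * (- (A * (s / w)) / (w * w))) (at s)"
    unfolding growth_def[abs_def] w_def by (rule derivative_eq_intros root nz refl | simp)+
  also have "(A / w - 1 / 2) + s * (- (A * (s / w)) / (w * w)) = A * (w * w - s * s) / w ^ 3 - 1 / 2"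
    using w(1) by (simp add: field_simps power3_eq_cube)
  also have "\<dots> = q s" unfolding q_def w(2) by (simp add: w_def)
  finally show "(growth A has_real_derivative q s) (at s)" .
  have "((\<lambda>s. sqrt (1 + s\<^sup>2) ^ 3) has_real_derivative 3 * w\<^sup>2 * (s / w)) (at s)"
    using DERIV_power[OF root, of 3 s] by (simp add: w_def mult_ac)
  from DERIV_diff[OF DERIV_divide[OF DERIV_const this] DERIV_const, of A "1 / 2"]
  have "(q has_real_derivative - (A * (3 * w\<^sup>2 * (s / w))) / (w ^ 3 * w ^ 3)) (at s)"
    using w(1) by (simp add: q_def w_def)
  also have "- (A * (3 * w\<^sup>2 * (s / w))) / (w ^ 3 * w ^ 3) = r s"
    unfolding r_def w_def[symmetric] using w(1) by (simp add: field_simps eval_nat_numeral)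
  finally show "(q has_real_derivative r s) (at s)" .
  show "continuous_on UNIV r"
    unfolding r_def using nz by (intro continuous_intros) auto
qed

text \<open>
  The constant \<open>3\<close> is a convenient upper bound for \<open>sqrt 2 ^ 3\<close>, the largest value of the
  denominator for \<open>\<bar>s\<bar> \<le> 1\<close>.
\<close>

lemma growth_deriv_bounds:
  fixes s :: real
  assumes "0 \<le> A"
  shows "- 1 / 2 \<le> A / (sqrt (1 + s\<^sup>2)) ^ 3 - 1 / 2"
    and "\<bar>A / (sqrt (1 + s\<^sup>2)) ^ 3 - 1 / 2\<bar> \<le> A + 1 / 2"
    and "\<bar>s\<bar> \<le> 1 \<Longrightarrow> A / 3 - 1 / 2 \<le> A / (sqrt (1 + s\<^sup>2)) ^ 3 - 1 / 2"
proof -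
  define w where "w = sqrt (1 + s\<^sup>2)"
  have w: "1 \<le> w" by (simp add: w_def)
  then have w3: "1 \<le> w ^ 3" by simp
  show 1: "- 1 / 2 \<le> A / (sqrt (1 + s\<^sup>2)) ^ 3 - 1 / 2"
    using assms by simp
  have "A / w ^ 3 \<le> A"
    using divide_left_mono[OF w3 assms] w by simp
  then show "\<bar>A / (sqrt (1 + s\<^sup>2)) ^ 3 - 1 / 2\<bar> \<le> A + 1 / 2"
    using 1 assms unfolding w_def by linarith
  assume "\<bar>s\<bar> \<le> 1"
  then have "s\<^sup>2 \<le> 1" by (simp add: abs_square_le_1)
  have "w ^ 3 = w\<^sup>2 * w" by (simp add: eval_nat_numeral)
  also have "w\<^sup>2 = 1 + s\<^sup>2" by (simp add: w_def add_pos_nonneg)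
  also have "(1 + s\<^sup>2) * w \<le> 2 * (3 / 2)"
  proof (rule mult_mono)
    show "w \<le> 3 / 2" unfolding w_def
      by (rule real_le_lsqrt) (use \<open>s\<^sup>2 \<le> 1\<close> in \<open>auto simp: power2_eq_square\<close>)
  qed (use \<open>s\<^sup>2 \<le> 1\<close> w in auto)
  finally have "w ^ 3 \<le> 3" by simp
  then have "A / 3 \<le> A / w ^ 3"
    using w by (intro divide_left_mono assms) auto
  then show "A / 3 - 1 / 2 \<le> A / (sqrt (1 + s\<^sup>2)) ^ 3 - 1 / 2"
    by (simp add: w_def)
qed

text \<open>
  The equation for \<open>ln x\<close> has a right-hand side with exactly one sign change, at the logarithm
  of the rest point, and this makes the convergence lemma above applicable on the whole line.  The
  logarithm is defined for all times since \<open>exp t (x t)^2\<close> never decreases: \<open>x\<close> cannot reach \<open>0\<close>.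
\<close>

lemma growth_flow_converges:
  assumes A: "1 \<le> A"
    and der: "\<And>t. 0 \<le> t \<Longrightarrow> (x has_real_derivative growth A (x t)) (at t within {0..})"
    and "0 < x 0"
  shows "(x \<longlongrightarrow> growth_rest A) at_top"
proof -
  define P where "P = growth_rest A"
  have P: "1 < P" "sqrt (1 + P\<^sup>2) = 2 * A"
    using A growth_rest_gt_1 sqrt_one_plus_growth_rest by (auto simp: P_def)
  have nonzero: "x t \<noteq> 0" if t: "0 \<le> t" for t
  proof
    assume "x t = 0"
    have "- (exp t * (x t)\<^sup>2) \<le> - (exp 0 * (x 0)\<^sup>2)"
    proof (rule nonincreasing_if_derivative_nonpos[OF t])
      fix s assume s: "s \<in> {0..t}"
      have "(x has_real_derivative growth A (x s)) (at s within {0..t})"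
        using s by (intro DERIV_subset[OF der]) auto
      then show "((\<lambda>s. - (exp s * (x s)\<^sup>2)) has_real_derivative
          - (exp s * (2 * (x s)\<^sup>2 * (A / sqrt (1 + (x s)\<^sup>2))))) (at s within {0..t})"
        by (auto intro!: derivative_eq_intros simp: growth_def power2_eq_square algebra_simps)
      show "- (exp s * (2 * (x s)\<^sup>2 * (A / sqrt (1 + (x s)\<^sup>2)))) \<le> 0"
        using A by simp
    qed
    with \<open>x t = 0\<close> \<open>0 < x 0\<close> show False by simp
  qed
  have cont: "continuous_on {0..} x"
    using der by (auto simp: continuous_on_eq_continuous_within intro!: DERIV_continuous)
  have pos: "0 < x t" if t: "0 \<le> t" for t
  proof (rule ccontr)
    assume "\<not> 0 < x t"
    then have "\<exists>s\<ge>0. s \<le> t \<and> x s = 0"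
      using \<open>0 < x 0\<close> t by (intro IVT2' continuous_on_subset[OF cont]) auto
    then show False using nonzero by blast
  qed
  define h where "h y = A / sqrt (1 + (exp y)\<^sup>2) - 1 / 2" for y
  have "((\<lambda>t. ln (x t)) \<longlongrightarrow> ln P) at_top"
  proof (rule scalar_ode_converges[where h = h])
    fix t :: real assume t: "0 \<le> t"
    show "((\<lambda>t. ln (x t)) has_real_derivative h (ln (x t))) (at t within {0..})"
      using pos[OF t] der[OF t] by (auto intro!: derivative_eq_intros simp: h_def growth_def)
  next
    have "sqrt (1 + (exp y)\<^sup>2) \<noteq> 0" for y :: real
      using add_pos_nonneg[of 1 "(exp y)\<^sup>2"] by simp
    then show "continuous_on UNIV h" unfolding h_def by (intro continuous_intros) auto
  next
    fix y assume "y \<noteq> ln P"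
    define r where "r = sqrt (1 + (exp y)\<^sup>2)"
    have r: "0 < r" unfolding r_def by (simp add: add_pos_nonneg)
    have h: "h y = (2 * A - r) / (2 * r)"
      using r by (simp add: h_def r_def[symmetric] field_simps)
    consider "y < ln P" | "ln P < y" using \<open>y \<noteq> ln P\<close> by linarith
    then show "(y - ln P) * h y < 0"
    proof cases
      case 1
      then have "exp y < P" using P(1) by (metis exp_less_cancel_iff exp_ln less_trans zero_less_one)
      then have "(exp y)\<^sup>2 < P\<^sup>2" by (intro power_strict_mono) auto
      then have "r < 2 * A" unfolding r_def P(2)[symmetric] by simp
      with 1 r show ?thesis unfolding h by (intro mult_neg_pos divide_pos_pos) auto
    next
      case 2
      then have "P < exp y" using P(1) by (metis exp_less_cancel_iff exp_ln less_trans zero_less_one)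
      then have "P\<^sup>2 < (exp y)\<^sup>2" using P(1) by (intro power_strict_mono) auto
      then have "2 * A < r" unfolding r_def P(2)[symmetric] by simp
      with 2 r show ?thesis unfolding h by (intro mult_pos_neg divide_neg_pos) auto
    qed
  qed
  then have "((\<lambda>t. exp (ln (x t))) \<longlongrightarrow> exp (ln P)) at_top"
    by (rule tendsto_exp)
  moreover have "\<forall>\<^sub>F t in at_top. exp (ln (x t)) = x t"
    using eventually_ge_at_top[of 0] by eventually_elim (use pos in auto)
  ultimately have "(x \<longlongrightarrow> exp (ln P)) at_top" by (rule Lim_transform_eventually)
  then show ?thesis using P(1) by (simp add: P_def[symmetric])
qed

section \<open>Splitting a vector into mean and deviation\<close>

definition mean :: "real ^ 'n \<Rightarrow> real" where
  "mean u = coord_sum u / of_nat CARD('n)"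

definition deviation :: "real ^ 'n \<Rightarrow> real ^ 'n" where
  "deviation u = u - vec (mean u)"

lemma linear_coord_sum: "linear coord_sum"
  by (rule linearI) (simp_all add: coord_sum_def sum.distrib sum_distrib_left)

lemma bounded_linear_mean: "bounded_linear mean"
proof -
  have "linear mean" unfolding mean_def[abs_def]
    by (rule linearI) (simp_all add: linear_add[OF linear_coord_sum] linear_scale[OF linear_coord_sum] add_divide_distrib)
  then show ?thesis by (simp add: linear_conv_bounded_linear)
qed

lemma bounded_linear_vec: "bounded_linear (vec :: real \<Rightarrow> real ^ 'n)"
proof -
  have "linear (vec :: real \<Rightarrow> real ^ 'n)" by (rule linearI) (simp_all add: vec_eq_iff)
  then show ?thesis by (simp add: linear_conv_bounded_linear)
qed

lemma bounded_linear_deviation: "bounded_linear deviation"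
  unfolding deviation_def[abs_def]
  by (intro bounded_linear_sub bounded_linear_ident bounded_linear_compose[OF bounded_linear_vec bounded_linear_mean])

lemma mean_vec [simp]: "mean (vec c :: real ^ 'n) = c"
  by (simp add: mean_def coord_sum_def)

lemma mean_axis: "mean (axis j 1 :: real ^ 'n) = 1 / of_nat CARD('n)"
  by (simp add: mean_def coord_sum_def axis_def)

lemmas mean_linear = bounded_linear.linear[OF bounded_linear_mean]
lemmas deviation_linear = bounded_linear.linear[OF bounded_linear_deviation]

lemma mean_deviation [simp]: "mean (deviation u) = 0"
  by (simp add: deviation_def linear_diff[OF mean_linear])

lemma zero_sum_space_iff_mean: "u \<in> zero_sum_space \<longleftrightarrow> mean u = 0"
  by (simp add: zero_sum_space_def mean_def)

lemma deviation_eq_self: "mean u = 0 \<Longrightarrow> deviation u = u"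
  by (simp add: deviation_def)

lemma deviation_vec [simp]: "deviation (vec c) = 0"
  by (simp add: deviation_def)

lemma deviation_plus_mean: "u = deviation u + vec (mean u)"
  by (simp add: deviation_def)

section \<open>The compactly supported perturbation\<close>

text \<open>
  The first cutoff is \<open>1\<close> for mean \<open>0\<close> and \<open>0\<close> as soon as the mean has absolute value at least \<open>1\<close>;
  the second one restricts \<open>g\<close> to a ball of squared radius \<open>r + 1\<close> in the hyperplane.  The summand
  \<open>deviation u\<close> compensates for the term \<open>- deviation u\<close> of the vector field, so that \<open>g\<close> itself remains
  where both cutoffs are \<open>1\<close>.
\<close>

definition perturbation :: "real \<Rightarrow> (real ^ 'n \<Rightarrow> real ^ 'n) \<Rightarrow> real ^ 'n \<Rightarrow> real ^ 'n" where
  "perturbation r g u = (cutoff 0 (mean u * mean u) * cutoff r (deviation u \<bullet> deviation u)) *\<^sub>R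
     (g (deviation u) + deviation u)"

lemma C2_on_perturbation:
  assumes "C2_on zero_sum_space g"
  shows "C2_on UNIV (perturbation r g)"
proof -
  note dev = C2_on_bounded_linear[OF bounded_linear_deviation, of UNIV]
  note mean = C2_on_bounded_linear[OF bounded_linear_mean, of UNIV]
  have "C2_on UNIV (\<lambda>u. g (deviation u))"
    by (rule C2_on_compose[OF assms dev]) (auto simp: zero_sum_space_iff_mean)
  moreover have "C2_on UNIV (\<lambda>u. cutoff 0 (mean u * mean u))"
    by (rule C2_on_compose[OF C2_on_cutoff _ subset_UNIV])
       (rule C2_on_bilinear[OF bounded_bilinear_mult mean mean])
  moreover have "C2_on UNIV (\<lambda>u. cutoff r (deviation u \<bullet> deviation u))"
    by (rule C2_on_compose[OF C2_on_cutoff _ subset_UNIV])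
       (rule C2_on_bilinear[OF bounded_bilinear_inner dev dev])
  ultimately show ?thesis
    unfolding perturbation_def[abs_def]
    by (intro C2_on_bilinear[OF bounded_bilinear_scaleR] C2_on_bilinear[OF bounded_bilinear_mult]
        C2_on_add dev)
qed

lemma mean_perturbation:
  assumes "g ` zero_sum_space \<subseteq> zero_sum_space"
  shows "mean (perturbation r g u) = 0"
proof -
  have "mean (g (deviation u)) = 0"
    using assms by (metis image_subset_iff mean_deviation zero_sum_space_iff_mean)
  then show ?thesis
    by (simp add: perturbation_def linear_scale[OF mean_linear] linear_add[OF mean_linear])
qed

lemma perturbation_eq_0:
  assumes "1 \<le> \<bar>mean u\<bar>"
  shows "perturbation r g u = 0"
proof -
  have "1 \<le> mean u * mean u"
    using assms mult_mono[OF assms assms] by (simp add: abs_mult_self_eq)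
  then show ?thesis by (simp add: perturbation_def cutoff_simps)
qed

text \<open>
  Where the perturbation does not vanish, the mean is at most \<open>1\<close> in absolute value and the
  deviation has squared norm below \<open>r + 1\<close>; the vector is the sum of these two parts.
\<close>

lemma perturbation_bounded_support:
  fixes g :: "real ^ 'n \<Rightarrow> real ^ 'n"
  obtains \<rho> where "\<And>u. \<rho> < norm u \<Longrightarrow> perturbation r g u = 0"
proof
  fix u :: "real ^ 'n"
  assume u: "sqrt (\<bar>r\<bar> + 1) + norm (vec 1 :: real ^ 'n) < norm u"
  show "perturbation r g u = 0"
  proof (cases "1 \<le> \<bar>mean u\<bar>")
    case True
    then show ?thesis by (rule perturbation_eq_0)
  next
    case False
    have "vec (mean u) = mean u *\<^sub>R (vec 1 :: real ^ 'n)" by (simp add: vec_eq_iff)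
    then have "norm (vec (mean u) :: real ^ 'n) \<le> norm (vec 1 :: real ^ 'n)"
      using False mult_left_le_one_le[of "norm (vec 1 :: real ^ 'n)" "\<bar>mean u\<bar>"] by simp
    moreover have "norm u \<le> norm (deviation u) + norm (vec (mean u) :: real ^ 'n)"
      using norm_triangle_ineq[of "deviation u" "vec (mean u)"] by (simp flip: deviation_plus_mean)
    ultimately have "sqrt (\<bar>r\<bar> + 1) < norm (deviation u)" using u by linarith
    then have "\<bar>r\<bar> + 1 < (norm (deviation u))\<^sup>2" by (metis norm_ge_zero not_le real_le_lsqrt real_sqrt_le_iff real_sqrt_abs real_norm_def abs_of_nonneg)
    then have "r + 1 \<le> deviation u \<bullet> deviation u" by (simp add: power2_norm_eq_inner)
    then show ?thesis by (simp add: perturbation_def cutoff_simps)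
  qed
qed

lemma perturbation_on_zero_sum:
  assumes "mean u = 0"
  shows "perturbation r g u = cutoff r (u \<bullet> u) *\<^sub>R (g u + u)"
  using assms by (simp add: perturbation_def deviation_eq_self cutoff_simps)

text \<open>
  On the hyperplane the vector field is the combination \<open>c g(u) - (1 - c) u\<close> with \<open>0 \<le> c \<le> 1\<close>,
  and both \<open>g(u)\<close> and \<open>- u\<close> have negative inner product with \<open>u\<close>.
\<close>

lemma perturbation_inner_less:
  assumes "mean u = 0" "g u \<bullet> u < 0"
  shows "perturbation r g u \<bullet> u < u \<bullet> u"
proof -
  define c where "c = cutoff r (u \<bullet> u)"
  have c: "0 \<le> c" "c \<le> 1" by (simp_all add: c_def cutoff_simps)
  have u: "0 < u \<bullet> u" using assms(2) by auto
  have "perturbation r g u \<bullet> u = c * (g u \<bullet> u) + c * (u \<bullet> u)"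
    by (simp add: perturbation_on_zero_sum[OF assms(1)] c_def inner_add_left algebra_simps)
  also have "\<dots> < u \<bullet> u"
  proof (cases "c = 0")
    case False
    then have "c * (g u \<bullet> u) < 0" using c assms(2) by (simp add: mult_pos_neg)
    moreover have "c * (u \<bullet> u) \<le> u \<bullet> u" using c u by (intro mult_left_le_one_le) auto
    ultimately show ?thesis by linarith
  qed (use u in simp)
  finally show ?thesis .
qed

section \<open>The cooperative vector field\<close>

definition cooperative_field :: "real \<Rightarrow> (real ^ 'n \<Rightarrow> real ^ 'n) \<Rightarrow> real ^ 'n \<Rightarrow> real ^ 'n" where
  "cooperative_field A N u = N u - deviation u + vec (growth A (mean u))"

lemma mean_cooperative_field:
  assumes "mean (N u) = 0"
  shows "mean (cooperative_field A N u) = growth A (mean u)"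
  using assms by (simp add: cooperative_field_def linear_add[OF mean_linear] linear_diff[OF mean_linear])

lemma deviation_cooperative_field:
  assumes "mean (N u) = 0"
  shows "deviation (cooperative_field A N u) = N u - deviation u"
  using assms
  by (simp add: cooperative_field_def linear_add[OF deviation_linear] linear_diff[OF deviation_linear]
      deviation_eq_self)

lemma C2_on_cooperative_field:
  assumes "C2_on UNIV N"
  shows "C2_on UNIV (cooperative_field A N)"
proof -
  have "C2_on UNIV (growth A)"
    using growth_derivs by (rule C2_on_real)
  then have "C2_on UNIV (\<lambda>u::real^'n. growth A (mean u))"
    by (rule C2_on_compose[OF _ C2_on_bounded_linear[OF bounded_linear_mean] subset_UNIV])
  then have "C2_on UNIV (\<lambda>u::real^'n. vec (growth A (mean u)) :: real^'n)"
    by (rule C2_on_compose[OF C2_on_bounded_linear[OF bounded_linear_vec, of UNIV] _ subset_UNIV])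
  moreover have "C2_on UNIV (\<lambda>u::real^'n. - deviation u)"
    by (intro C2_on_bounded_linear bounded_linear_minus bounded_linear_deviation)
  ultimately have "C2_on UNIV (\<lambda>u. (N u + - deviation u) + vec (growth A (mean u)))"
    by (intro C2_on_add assms)
  then show ?thesis by (simp add: cooperative_field_def[abs_def])
qed

lemma lipschitz_growth:
  assumes "0 \<le> A"
  shows "(A + 1 / 2)-lipschitz_on UNIV (growth A)"
proof (rule bounded_derivative_imp_lipschitz)
  fix s
  show "(growth A has_derivative (*) (A / (sqrt (1 + s\<^sup>2)) ^ 3 - 1 / 2)) (at s within UNIV)"
    using growth_derivs(1)[of A s] by (simp add: has_field_derivative_def)
  show "onorm ((*) (A / (sqrt (1 + s\<^sup>2)) ^ 3 - 1 / 2)) \<le> A + 1 / 2"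
  proof (rule onorm_bound)
    fix x :: real
    show "norm ((A / (sqrt (1 + s\<^sup>2)) ^ 3 - 1 / 2) * x) \<le> (A + 1 / 2) * norm x"
      unfolding norm_mult unfolding real_norm_def
      by (intro mult_right_mono growth_deriv_bounds assms) auto
  qed (use assms in auto)
qed (use assms in auto)

text \<open>
  The perturbation is Lipschitz because its derivative is bounded, the last term because \<open>growth A\<close>
  has bounded slope, and the middle one because it is linear.
\<close>

lemma lipschitz_cooperative_field:
  fixes N :: "real ^ 'n \<Rightarrow> real ^ 'n"
  assumes "0 \<le> A" and "\<And>x. (N has_derivative blinfun_apply (D x)) (at x)" "\<And>x. norm (D x) \<le> B"
  obtains L where "L-lipschitz_on UNIV (cooperative_field A N)"
proof -
  have N: "B-lipschitz_on UNIV N"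
  proof (rule bounded_derivative_imp_lipschitz)
    show "0 \<le> B" using assms(3)[of 0] norm_ge_zero order_trans by blast
  qed (use assms in \<open>auto simp flip: norm_blinfun.rep_eq\<close>)
  obtain a where a: "a-lipschitz_on UNIV (deviation :: real ^ 'n \<Rightarrow> real ^ 'n)"
    using bounded_linear.lipschitz_boundE[OF bounded_linear_deviation] by blast
  obtain b where b: "b-lipschitz_on UNIV (mean :: real ^ 'n \<Rightarrow> real)"
    using bounded_linear.lipschitz_boundE[OF bounded_linear_mean] by blast
  obtain c where c: "c-lipschitz_on UNIV (vec :: real \<Rightarrow> real ^ 'n)"
    using bounded_linear.lipschitz_boundE[OF bounded_linear_vec] by blast
  have "(c * ((A + 1 / 2) * b))-lipschitz_on UNIV (\<lambda>u::real^'n. vec (growth A (mean u)) :: real ^ 'n)"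
    using lipschitz_on_compose2[OF lipschitz_on_compose2[OF b lipschitz_on_subset[OF lipschitz_growth[OF assms(1)] subset_UNIV]]
        lipschitz_on_subset[OF c subset_UNIV]] .
  from lipschitz_on_add[OF lipschitz_on_diff[OF N a] this]
  show ?thesis by (intro that) (simp add: cooperative_field_def[abs_def])
qed

text \<open>
  With \<open>n\<close> coordinates the partial derivative is \<open>d + 1/n + q/n\<close>, where \<open>d\<close> is that of \<open>N\<close> and \<open>q\<close>
  the slope of \<open>growth A\<close> at the mean.  For mean at most \<open>1\<close> in absolute value, \<open>A/(3n) \<ge> B \<ge> \<bar>d\<bar>\<close>;
  beyond that, \<open>d = 0\<close> and the bound \<open>q \<ge> - 1/2\<close> is enough.
\<close>

lemma partial_deriv_cooperative_field_pos:
  fixes N :: "real ^ 'n \<Rightarrow> real ^ 'n"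
  assumes der: "\<And>x. (N has_derivative blinfun_apply (D x)) (at x)" and B: "\<And>x. norm (D x) \<le> B"
    and van: "\<And>x. 1 \<le> \<bar>mean x\<bar> \<Longrightarrow> N x = 0"
    and A: "3 * of_nat CARD('n) * B \<le> A"
    and "i \<noteq> j"
  shows "0 < partial_deriv j (\<lambda>x. cooperative_field A N x $ i) u"
proof -
  define n where "n = real CARD('n)"
  have n: "1 \<le> n" by (simp add: n_def Suc_leI)
  have "0 \<le> B" using B[of 0] norm_ge_zero order_trans by blast
  then have A0: "0 \<le> A" using A n by (meson mult_nonneg_nonneg of_nat_0_le_iff order_trans zero_le_numeral)
  define e :: "real ^ 'n" where "e = axis j 1"
  have e: "e $ i = 0" "norm e = 1" "mean e = 1 / n"
    using \<open>i \<noteq> j\<close> by (simp_all add: e_def mean_axis n_def) (simp add: axis_def)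
  define m where "m = mean u"
  have mean: "mean (u + s *\<^sub>R e) = m + s / n" for s
    by (simp add: linear_add[OF mean_linear] linear_scale[OF mean_linear] e m_def)
  define d where "d = blinfun_apply (D u) e $ i"
  define q where "q = A / (sqrt (1 + m\<^sup>2)) ^ 3 - 1 / 2"
  have "((\<lambda>s. u + s *\<^sub>R e) has_derivative (\<lambda>s. s *\<^sub>R e)) (at 0)"
    by (auto intro!: derivative_eq_intros)
  then have "((\<lambda>s. N (u + s *\<^sub>R e)) has_derivative (\<lambda>s. D u (s *\<^sub>R e))) (at 0)"
    by (rule has_derivative_compose) (use der in simp)
  from bounded_linear.has_derivative[OF bounded_linear_vec_nth this, of i]
  have N': "((\<lambda>s. N (u + s *\<^sub>R e) $ i) has_real_derivative d) (at 0)"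
    unfolding has_field_derivative_def
    by (rule has_derivative_eq_rhs) (simp add: d_def blinfun.scaleR_right fun_eq_iff)
  have g': "((\<lambda>s. growth A (m + s / n)) has_real_derivative q * (1 / n)) (at 0)"
  proof (rule DERIV_chain2[where f = "growth A"])
    show "(growth A has_real_derivative q) (at (m + 0 / n))"
      using growth_derivs(1)[of A m] by (simp add: q_def)
  qed (use n in \<open>auto intro!: derivative_eq_intros\<close>)
  have "cooperative_field A N (u + s *\<^sub>R e) $ i =
      N (u + s *\<^sub>R e) $ i - (u $ i - m - s / n) + growth A (m + s / n)" for s
    by (simp add: cooperative_field_def deviation_def mean e)
  moreover have "((\<lambda>s. N (u + s *\<^sub>R e) $ i - (u $ i - m - s / n) + growth A (m + s / n))
      has_real_derivative d - (0 - 0 - 1 / n) + q * (1 / n)) (at 0)"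
    by (intro DERIV_add DERIV_diff N' g' DERIV_const DERIV_cdivide DERIV_ident)
  ultimately have "partial_deriv j (\<lambda>x. cooperative_field A N x $ i) u = d + 1 / n + q / n"
    unfolding partial_deriv_def e_def[symmetric] by (simp add: DERIV_imp_deriv)
  moreover have "0 < d + 1 / n + q / n"
  proof (cases "\<bar>m\<bar> \<le> 1")
    case True
    have "\<bar>d\<bar> \<le> norm (D u e)" unfolding d_def by (rule component_le_norm_cart)
    also have "\<dots> \<le> B" using norm_blinfun[of "D u" e] B[of u] e by simp
    finally have "- B \<le> d" by linarith
    moreover have "(A / 3 - 1 / 2) / n \<le> q / n"
      using growth_deriv_bounds(3)[OF A0 True] n by (intro divide_right_mono) (auto simp: q_def)
    moreover have "B \<le> A / 3 / n" using A n by (simp add: n_def field_simps)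
    moreover have "(A / 3 - 1 / 2) / n = A / 3 / n - 1 / 2 / n" by (simp add: diff_divide_distrib)
    moreover have "1 / 2 / n < 1 / n" using n by (simp add: field_simps)
    ultimately show ?thesis by linarith
  next
    case False
    have "open {x::real^'n. 1 < \<bar>mean x\<bar>}"
      by (intro open_Collect_less continuous_intros linear_continuous_on bounded_linear_mean)
    then have "((\<lambda>x. 0) has_derivative blinfun_apply (D u)) (at u)"
      by (rule has_derivative_transform_within_open[OF der]) (use False van in \<open>auto simp: m_def\<close>)
    then have "blinfun_apply (D u) = (\<lambda>h. 0)"
      using has_derivative_unique has_derivative_const by blast
    then have "d = 0" by (simp add: d_def)
    moreover have "(- 1 / 2) / n \<le> q / n"
      using growth_deriv_bounds(1)[OF A0, of m] n by (intro divide_right_mono) (auto simp: q_def)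
    moreover have "(- 1 / 2) / n + 1 / n > 0" using n by (simp add: field_simps)
    ultimately show ?thesis by linarith
  qed
  ultimately show ?thesis by simp
qed

text \<open>
  The sign \<open>c\<close> treats both half-spaces at once: \<open>growth A\<close> is odd, so \<open>c\<close> times the mean obeys the
  same equation and starts positive.  After the time at which it exceeds \<open>1\<close>, the deviation decays
  exponentially.
\<close>

lemma cooperative_field_solution_converges:
  fixes N :: "real ^ 'n \<Rightarrow> real ^ 'n"
  assumes A: "1 \<le> A" and mN: "\<And>x. mean (N x) = 0"
    and van: "\<And>x. 1 \<le> \<bar>mean x\<bar> \<Longrightarrow> N x = 0"
    and sol: "ode_solution (cooperative_field A N) {0..} u"
    and c: "c = 1 \<or> c = -1" and start: "0 < c * mean (u 0)"
  shows "(u \<longlongrightarrow> vec (c * growth_rest A)) at_top"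
proof -
  let ?P = "growth_rest A"
  have der: "(u has_vector_derivative cooperative_field A N (u t)) (at t within {0..})" if "0 \<le> t" for t
    using sol that by (auto simp: ode_solution_def)
  have lim: "((\<lambda>t. c * mean (u t)) \<longlongrightarrow> ?P) at_top"
  proof (rule growth_flow_converges[OF A])
    fix t :: real assume t: "0 \<le> t"
    have "((\<lambda>t. mean (u t)) has_real_derivative growth A (mean (u t))) (at t within {0..})"
      using bounded_linear.has_vector_derivative[OF bounded_linear_mean der[OF t]]
      by (simp add: mean_cooperative_field mN has_real_derivative_iff_has_vector_derivative)
    from DERIV_cmult[OF this, of c]
    show "((\<lambda>t. c * mean (u t)) has_real_derivative growth A (c * mean (u t))) (at t within {0..})"
      using c by (auto simp: growth_uminus)
  qed (fact start)
  have "((\<lambda>t. c * (c * mean (u t))) \<longlongrightarrow> c * ?P) at_top"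
    by (intro tendsto_intros lim)
  then have mean: "((\<lambda>t. mean (u t)) \<longlongrightarrow> c * ?P) at_top"
    using c by auto
  have "\<forall>\<^sub>F t in at_top. 1 < c * mean (u t)"
    using order_tendstoD(1)[OF lim growth_rest_gt_1[OF A]] .
  then obtain T' where T': "\<And>t. T' \<le> t \<Longrightarrow> 1 < c * mean (u t)"
    by (auto simp: eventually_at_top_linorder)
  define T where "T = max 0 T'"
  have T: "N (u t) = 0" if "T \<le> t" for t
    using T'[of t] that c by (intro van) (auto simp: T_def)
  (* from time T on the deviation solves v' = - v, so exp t times it is constant *)
  have "\<exists>v. \<forall>t\<in>{T..}. exp t *\<^sub>R deviation (u t) = v"
  proof (rule has_derivative_zero_constant)
    fix t assume t: "t \<in> {T..}"
    have "((\<lambda>t. deviation (u t)) has_vector_derivative - deviation (u t)) (at t within {0..})"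
      using bounded_linear.has_vector_derivative[OF bounded_linear_deviation der[of t]] t
      by (simp add: deviation_cooperative_field mN T T_def)
    then have "((\<lambda>t. deviation (u t)) has_vector_derivative - deviation (u t)) (at t within {T..})"
      by (rule has_vector_derivative_within_subset) (auto simp: T_def)
    moreover have "(exp has_real_derivative exp t) (at t within {T..})"
      by (auto intro!: derivative_eq_intros)
    ultimately have "((\<lambda>t. exp t *\<^sub>R deviation (u t)) has_vector_derivative
        exp t *\<^sub>R (- deviation (u t)) + exp t *\<^sub>R deviation (u t)) (at t within {T..})"
      by (intro has_vector_derivative_scaleR)
    then show "((\<lambda>t. exp t *\<^sub>R deviation (u t)) has_derivative (\<lambda>h. 0)) (at t within {T..})"
      by (simp add: has_vector_derivative_def)
  qed simp
  then obtain v where v: "\<And>t. T \<le> t \<Longrightarrow> exp t *\<^sub>R deviation (u t) = v" by auto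
  have "\<forall>\<^sub>F t in at_top. exp (- t) *\<^sub>R v = deviation (u t)"
    using eventually_ge_at_top[of T]
    by eventually_elim (simp add: exp_minus flip: v)
  moreover have "((\<lambda>t. exp (- t)) \<longlongrightarrow> (0::real)) at_top"
    by (rule filterlim_compose[OF exp_at_bot filterlim_uminus_at_bot_at_top])
  then have "((\<lambda>t. exp (- t) *\<^sub>R v) \<longlongrightarrow> 0) at_top"
    using tendsto_scaleR[OF _ tendsto_const] by fastforce
  ultimately have "((\<lambda>t. deviation (u t)) \<longlongrightarrow> 0) at_top"
    by (rule Lim_transform_eventually[rotated])
  from tendsto_add[OF this bounded_linear.tendsto[OF bounded_linear_vec mean]]
  have "((\<lambda>t. deviation (u t) + vec (mean (u t))) \<longlongrightarrow> vec (c * ?P)) at_top" by simp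
  then show ?thesis by (simp flip: deviation_plus_mean)
qed

text \<open>
  The mean and the deviation of a zero both vanish when computed from the vector field, which
  gives \<open>growth A (mean u) = 0\<close> and \<open>N u = deviation u\<close>.
\<close>

lemma cooperative_field_zeros:
  assumes A: "1 \<le> A" and mN: "\<And>x. mean (N x) = 0"
    and van: "\<And>x. 1 \<le> \<bar>mean x\<bar> \<Longrightarrow> N x = 0"
    and zero: "cooperative_field A N u = 0"
  shows "(mean u = 0 \<and> N u = u) \<or> u = vec (growth_rest A) \<or> u = - vec (growth_rest A)"
proof -
  have "growth A (mean u) = 0" "N u = deviation u"
    using mean_cooperative_field[where N = N, OF mN, of A u] deviation_cooperative_field[where N = N, OF mN, of A u] zero
    by (simp_all add: linear_0[OF mean_linear] linear_0[OF deviation_linear])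
  from growth_eq_0[OF A this(1)] show ?thesis
  proof
    assume "mean u = 0"
    then show ?thesis using \<open>N u = deviation u\<close> by (simp add: deviation_eq_self)
  next
    assume m: "\<bar>mean u\<bar> = growth_rest A"
    then have "deviation u = 0" using van[of u] growth_rest_gt_1[OF A] \<open>N u = deviation u\<close> by simp
    then have "u = vec (mean u)" using deviation_plus_mean[of u] by simp
    moreover have "mean u = growth_rest A \<or> mean u = - growth_rest A" using m by linarith
    ultimately show ?thesis by (metis vec_neg)
  qed
qed

section \<open>Embedding of a given flow on the zero-sum hyperplane\<close>

theorem theorem1:
  fixes g :: "real ^ 'n \<Rightarrow> real ^ 'n" and R :: "(real ^ 'n) set"
  assumes "g ` zero_sum_space \<subseteq> zero_sum_space"
    and "C2_on zero_sum_space g"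
    and "R \<subseteq> zero_sum_space"
    and "compact R"
  shows "\<exists>f :: real ^ 'n \<Rightarrow> real ^ 'n.
    C2_on UNIV f \<and>
    (\<forall>u i j. i \<noteq> j \<longrightarrow> partial_deriv j (\<lambda>x. f x $ i) u > 0) \<and>
    (\<forall>u\<in>R. g u = f u) \<and>
    (\<exists>P>0.
      (\<forall>J u. forward_maximal_solution f J u \<and> coord_sum (u 0) > 0 \<longrightarrow>
         J = {0..} \<and> (u \<longlongrightarrow> vec P) at_top) \<and>
      (\<forall>J u. forward_maximal_solution f J u \<and> coord_sum (u 0) < 0 \<longrightarrow>
         J = {0..} \<and> (u \<longlongrightarrow> - vec P) at_top) \<and>
      ((\<forall>u \<in> zero_sum_space - R. g u \<bullet> u < 0) \<longrightarrow>
         (\<forall>u. f u = 0 \<longrightarrow> (u \<in> zero_sum_space \<and> g u = 0) \<or> u = vec P \<or> u = - vec P)))"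
proof -
  obtain b where b: "\<And>u. u \<in> R \<Longrightarrow> norm u \<le> b"
    using compact_imp_bounded[OF assms(4)] by (auto simp: bounded_iff)
  define N where "N = perturbation (b\<^sup>2) g"
  have C2N: "C2_on UNIV N" unfolding N_def using assms(2) by (rule C2_on_perturbation)
  have mN: "mean (N x) = 0" for x unfolding N_def using assms(1) by (rule mean_perturbation)
  have van: "N x = 0" if "1 \<le> \<bar>mean x\<bar>" for x unfolding N_def using that by (rule perturbation_eq_0)
  obtain \<rho> where "\<forall>u. \<rho> < norm u \<longrightarrow> N u = 0"
    unfolding N_def using perturbation_bounded_support by metis
  then obtain D B where D: "\<And>x. (N has_derivative blinfun_apply (D x)) (at x)" "\<And>x. norm (D x) \<le> B"
    using C1_bounded_support_bounded_derivative[OF C2_on_imp_C1_on[OF C2N]] by metis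
  have "0 \<le> B" using D(2)[of 0] norm_ge_zero order_trans by blast
  (* the summand 1 ensures 1 < growth_rest A: the rest points lie outside the slab where N is active *)
  define A where "A = 3 * real CARD('n) * B + 1"
  have A: "1 \<le> A" "3 * real CARD('n) * B \<le> A" using \<open>0 \<le> B\<close> by (auto simp: A_def)
  define f where "f = cooperative_field A N"
  define P where "P = growth_rest A"
  have P: "0 < P" using growth_rest_gt_1[OF A(1)] by (simp add: P_def)
  obtain L where L: "L-lipschitz_on UNIV f"
    unfolding f_def using lipschitz_cooperative_field[of A N D B] A(1) D by auto
  have NR: "N u = g u + u" if "u \<in> R" for u
  proof -
    have "u \<bullet> u \<le> b\<^sup>2"
      using power_mono[OF b[OF that] norm_ge_zero, of 2] by (simp add: power2_norm_eq_inner)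
    moreover have "mean u = 0" using assms(3) that by (auto simp: zero_sum_space_iff_mean)
    ultimately show ?thesis by (simp add: N_def perturbation_on_zero_sum cutoff_simps)
  qed
  have conv: "J = {0..} \<and> (u \<longlongrightarrow> vec (c * P)) at_top"
    if u: "forward_maximal_solution f J u" and c: "c = 1 \<or> c = -1" "0 < c * mean (u 0)" for J u c
  proof -
    have J: "J = {0..}" using L u by (rule lipschitz_forward_maximal_global)
    then have "ode_solution (cooperative_field A N) {0..} u"
      using u by (simp add: forward_maximal_solution_def f_def)
    from cooperative_field_solution_converges[where N = N, OF A(1) mN van this c]
    show ?thesis using J by (simp add: P_def)
  qed
  show ?thesis
  proof (rule exI[of _ f], intro conjI allI impI ballI exI[of _ P])
    show "C2_on UNIV f" unfolding f_def using C2N by (rule C2_on_cooperative_field)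
    show "0 < partial_deriv j (\<lambda>x. f x $ i) u" if "i \<noteq> j" for u i j
      unfolding f_def using D van A(2) that by (rule partial_deriv_cooperative_field_pos)
    show "g u = f u" if "u \<in> R" for u
    proof -
      have "mean u = 0" using assms(3) that by (auto simp: zero_sum_space_iff_mean)
      then show ?thesis by (simp add: f_def cooperative_field_def NR[OF that] deviation_eq_self growth_def)
    qed
    show "0 < P" by (fact P)
    show "J = {0..}" "(u \<longlongrightarrow> vec P) at_top"
      if "forward_maximal_solution f J u \<and> 0 < coord_sum (u 0)" for J u
      using conv[of J u 1] that by (auto simp: mean_def)
    show "J = {0..}" "(u \<longlongrightarrow> - vec P) at_top"
      if "forward_maximal_solution f J u \<and> coord_sum (u 0) < 0" for J u
      using conv[of J u "-1"] that by (auto simp: mean_def vec_neg divide_neg_pos)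
    show "(u \<in> zero_sum_space \<and> g u = 0) \<or> u = vec P \<or> u = - vec P"
      if inward: "\<forall>u \<in> zero_sum_space - R. g u \<bullet> u < 0" and "f u = 0" for u
    proof -
      have "g u = 0" if u: "mean u = 0" "N u = u"
      proof (cases "u \<in> R")
        case True
        then show ?thesis using NR[of u] u by simp
      next
        case False
        then have "N u \<bullet> u < u \<bullet> u"
          unfolding N_def using u inward by (intro perturbation_inner_less) (auto simp: zero_sum_space_iff_mean)
        then show ?thesis using u by simp
      qed
      then show ?thesis
        using cooperative_field_zeros[where N = N, OF A(1) mN van, of u] \<open>f u = 0\<close>
        by (auto simp: f_def P_def zero_sum_space_iff_mean)
    qed
  qed
qed

end
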